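(* Let $q>0$ with $q\neq 1$, let $r$ be a real number, and let $x$ be an indeterminate. For $n\ge 0$ let $$\Phi_n(x,r)=\sum_{k=0}^n S(n,k,r)\,q^{\binom{k}{2}}(q^r x)^k,$$ where the generalized $q$-Stirling numbers $S(n,k,r)$ are defined by $S(0,k,r)=[k=0]$ for $k\ge 0$, $S(n,0,r)=[r]^n$ for $n\ge 0$, and $S(n,k,r)=S(n-1,k-1,r)+[k+r]\,S(n-1,k,r)$ for $n,k\ge 1$. For $n\ge 1$ and $m\ge 0$ let $D(n,m)=\det\big(\Phi_{i+j+m}(x,r)\big)_{i,j=0}^{n-1}$. Then $$D(n,0)=q^{2\binom{n}{3}+2r\binom{n}{2}}\,x^{\binom{n}{2}}\prod_{k=0}^{n-1}\Big([k]!\,\big((1-q)x;q\big)_k\Big)$$ and $$D(n,1)=D(n,0)\sum_{k=0}^n \begin{bmatrix} n\\ k\end{bmatrix}\big(q^{n-1+r}x\big)^k\prod_{j=0}^{n-k-1}[r+j].$$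
   Context: Notation: $[t]=\frac{1-q^t}{1-q}$ for real $t$; $[n]!=[1][2]\cdots[n]$ for integers $n\ge 0$ (with $[0]!=1$); $\begin{bmatrix} n\\ k\end{bmatrix}=\frac{[n]!}{[k]![n-k]!}$ for integers $0\le k\le n$ and $0$ otherwise; $[P]$ for a statement $P$ is $1$ if $P$ holds and $0$ otherwise; $(y;q)_k=\prod_{j=0}^{k-1}(1-q^j y)$. An empty product equals $1$. *)

theory Defs
  imports Complex_Main "Jordan_Normal_Form.Determinant"
begin

definition qnum :: "real \<Rightarrow> real \<Rightarrow> real" where
  "qnum q t = (1 - q powr t) / (1 - q)"

definition qfact :: "real \<Rightarrow> nat \<Rightarrow> real" where
  "qfact q n = (\<Prod>i = 1..n. qnum q (real i))"

definition qbinom :: "real \<Rightarrow> nat \<Rightarrow> nat \<Rightarrow> real" where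
  "qbinom q n k = (if k \<le> n then qfact q n / (qfact q k * qfact q (n - k)) else 0)"

definition qpoch :: "real \<Rightarrow> real poly \<Rightarrow> nat \<Rightarrow> real poly" where
  "qpoch q y k = (\<Prod>j<k. 1 - smult (q ^ j) y)"

fun qStirling :: "real \<Rightarrow> nat \<Rightarrow> nat \<Rightarrow> real \<Rightarrow> real" where
  "qStirling q 0 k r = of_bool (k = 0)"
| "qStirling q (Suc n) 0 r = qnum q r ^ Suc n"
| "qStirling q (Suc n) (Suc k) r =
     qStirling q n k r + qnum q (real (Suc k) + r) * qStirling q n (Suc k) r"

text \<open>
  Everything lives in the polynomial ring over the reals: the argument \<open>x\<close> below is a polynomial,
  and the indeterminate itself is \<open>[:0, 1:]\<close>. Scalars act by \<^const>\<open>smult\<close>.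
\<close>

definition Phi :: "real \<Rightarrow> nat \<Rightarrow> real poly \<Rightarrow> real \<Rightarrow> real poly" where
  "Phi q n x r =
     (\<Sum>k = 0..n. smult (qStirling q n k r * q ^ (k choose 2)) (smult (q powr r) x ^ k))"

definition hankelD :: "real \<Rightarrow> real poly \<Rightarrow> real \<Rightarrow> nat \<Rightarrow> nat \<Rightarrow> real poly" where
  "hankelD q x r n m = det (mat n n (\<lambda>(i, j). Phi q (i + j + m) x r))"

end

theory Submission
  imports Defs
begin

text \<open>
  Let \<open>L\<close> be the linear functional with \<open>L(z^n) = \<Phi>\<^sub>n\<close>, let \<open>a\<^sub>k = [r + k]\<close>,
  \<open>w\<^sub>k = (z - a\<^sub>0) \<dots> (z - a\<^sub>k\<^sub>-\<^sub>1)\<close> and \<open>X = q^r x\<close>. The \<open>q\<close>-Stirling recursion says that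
  \<open>L(w\<^sub>k) = q^(k choose 2) X^k\<close>, equivalently \<open>L((z - a\<^sub>0) g(z)) = X L(g(q z + 1))\<close> for every \<open>g\<close>.
  The monic \<open>q\<close>-Charlier-type polynomials \<open>p\<^sub>n = \<Sum>\<^sub>k [n choose k]\<^sub>q (- q^(n - 1) X)^(n - k) w\<^sub>k\<close> satisfy
  \<open>p\<^sub>n\<^sub>+\<^sub>1(q z + 1) = q^(n + 1) p\<^sub>n\<^sub>+\<^sub>1 + \<beta>\<^sub>n p\<^sub>n\<close>, and \<open>L(p\<^sub>n) = 0\<close> for \<open>n > 0\<close> by the \<open>q\<close>-binomial
  theorem, so by induction they are orthogonal for \<open>L\<close> with explicit norms. The first Hankel
  determinant is the product of these norms. The shifted Hankel matrix is the unshifted one times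
  the companion matrix of \<open>p\<^sub>n\<close>, whose determinant is \<open>(- 1)^n p\<^sub>n(0)\<close>.
\<close>

section \<open>Linear functionals given by their moments\<close>

definition moment_functional :: "(nat \<Rightarrow> 'a::comm_ring_1) \<Rightarrow> 'a poly \<Rightarrow> 'a" where
  "moment_functional \<mu> f = (\<Sum>i\<le>degree f. coeff f i * \<mu> i)"

lemma moment_functional_bound:
  assumes "degree f \<le> N"
  shows "moment_functional \<mu> f = (\<Sum>i\<le>N. coeff f i * \<mu> i)"
  unfolding moment_functional_def
  by (rule sum.mono_neutral_left) (use assms in \<open>auto simp: coeff_eq_0\<close>)

lemma moment_functional_add:
  "moment_functional \<mu> (f + g) = moment_functional \<mu> f + moment_functional \<mu> g"
proof -
  define N where "N = max (degree f) (degree g)"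
  have "degree (f + g) \<le> N" "degree f \<le> N" "degree g \<le> N"
    by (simp_all add: N_def degree_add_le_max)
  then show ?thesis
    by (simp add: moment_functional_bound[of _ N] sum.distrib algebra_simps)
qed

lemma moment_functional_smult:
  "moment_functional \<mu> (smult c f) = c * moment_functional \<mu> f"
proof -
  have "degree (smult c f) \<le> degree f"
    by (rule degree_smult_le)
  then show ?thesis
    by (simp add: moment_functional_bound[of _ "degree f"] sum_distrib_left mult.assoc)
qed

lemma smult_sum_right: "smult c (\<Sum>i\<in>A. f i) = (\<Sum>i\<in>A. smult c (f i))"
  by (induction A rule: infinite_finite_induct) (simp_all add: smult_add_right)

lemma moment_functional_0 [simp]: "moment_functional \<mu> 0 = 0"
  by (simp add: moment_functional_def)

lemma moment_functional_sum:
  "moment_functional \<mu> (\<Sum>i\<in>A. f i) = (\<Sum>i\<in>A. moment_functional \<mu> (f i))"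
  by (induction A rule: infinite_finite_induct) (simp_all add: moment_functional_add)

lemma moment_functional_monom: "moment_functional \<mu> (monom c n) = c * \<mu> n"
proof -
  have "moment_functional \<mu> (monom c n) = (\<Sum>i\<le>n. coeff (monom c n) i * \<mu> i)"
    by (rule moment_functional_bound) (rule degree_monom_le)
  also have "\<dots> = (\<Sum>i\<le>n. if n = i then c * \<mu> i else 0)"
    by (rule sum.cong) auto
  finally show ?thesis
    by simp
qed

section \<open>Newton polynomials and their moments\<close>

definition newton_poly :: "(nat \<Rightarrow> 'a::comm_ring_1) \<Rightarrow> nat \<Rightarrow> 'a poly" where
  "newton_poly a k = (\<Prod>j<k. [:- a j, 1:])"

lemma newton_poly_0 [simp]: "newton_poly a 0 = 1"
  by (simp add: newton_poly_def)

lemma newton_poly_Suc: "newton_poly a (Suc k) = newton_poly a k * [:- a k, 1:]"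
  by (simp add: newton_poly_def)

text \<open>Splits off the first node rather than the last: the substitution \<open>q z + 1\<close>
  later carries the remaining nodes back to the original ones.\<close>

lemma newton_poly_Suc_shift:
  "newton_poly a (Suc k) = [:- a 0, 1:] * newton_poly (\<lambda>j. a (Suc j)) k"
  unfolding newton_poly_def by (subst prod.lessThan_Suc_shift) simp

lemma mult_linear: "f * [:- c, 1:] = pCons 0 f - smult c (f::'a::comm_ring_1 poly)"
  by (simp add: mult.commute[of f])

lemma degree_newton_poly_le: "degree (newton_poly a k) \<le> k"
proof (induction k)
  case (Suc k)
  have "degree (newton_poly a k * [:- a k, 1:]) \<le> degree (newton_poly a k) + degree [:- a k, 1:]"
    by (rule degree_mult_le)
  then show ?case
    using Suc by (simp add: newton_poly_Suc)
qed simp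

lemma coeff_newton_poly_self: "coeff (newton_poly a k) k = 1"
proof (induction k)
  case (Suc k)
  have "coeff (newton_poly a k) (Suc k) = 0"
    using degree_newton_poly_le[of a k] by (intro coeff_eq_0) simp
  then show ?case
    using Suc by (simp only: newton_poly_Suc mult_linear coeff_diff coeff_smult coeff_pCons) simp
qed simp

text \<open>The recursion makes \<open>S n k\<close> the coefficients of \<open>z^n\<close> in the
  Newton basis. Applying the functional gives a unitriangular system for the Newton moments, and
  \<open>v\<close> solves the same system, so strong induction identifies the two.\<close>

lemma moment_functional_newton_poly:
  fixes S :: "nat \<Rightarrow> nat \<Rightarrow> 'a::comm_ring_1"
  assumes S_0: "\<And>k. S 0 k = of_bool (k = 0)"
    and S_Suc_0: "\<And>n. S (Suc n) 0 = a 0 * S n 0"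
    and S_Suc_Suc: "\<And>n k. S (Suc n) (Suc k) = S n k + a (Suc k) * S n (Suc k)"
    and moments: "\<And>n. \<mu> n = (\<Sum>k\<le>n. S n k * v k)"
  shows "moment_functional \<mu> (newton_poly a n) = v n"
proof -
  let ?w = "newton_poly a"
  have S_zero: "S n k = 0" if "n < k" for n k
    using that
  proof (induction n arbitrary: k)
    case (Suc n)
    then obtain j where "k = Suc j" by (cases k) auto
    then show ?case using Suc by (simp add: S_Suc_Suc)
  qed (simp add: S_0)
  have S_self: "S n n = 1" for n
    by (induction n) (simp_all add: S_0 S_Suc_Suc S_zero)
  have expansion: "monom 1 n = (\<Sum>k\<le>n. smult (S n k) (?w k))" for n
  proof (induction n)
    case 0
    then show ?case by (simp add: S_0 monom_0)
  next
    case (Suc n)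
    let ?t = "\<lambda>k. smult (a k * S n k) (?w k)"
    have "monom 1 (Suc n) = monom 1 n * [:0, 1::'a:]"
      by (simp add: monom_Suc)
    also have "\<dots> = (\<Sum>k\<le>n. smult (S n k) (?w (Suc k)) + ?t k)"
      unfolding Suc sum_distrib_right
      by (rule sum.cong) (simp_all add: newton_poly_Suc smult_add_right smult_diff_right mult.commute)
    also have "\<dots> = (\<Sum>k\<le>n. smult (S n k) (?w (Suc k))) + (\<Sum>k\<le>Suc n. ?t k)"
      by (simp add: sum.distrib S_zero)
    also have "(\<Sum>k\<le>Suc n. ?t k) = ?t 0 + (\<Sum>k\<le>n. ?t (Suc k))"
      by (rule sum.atMost_Suc_shift)
    also have "(\<Sum>k\<le>n. smult (S n k) (?w (Suc k))) + (?t 0 + (\<Sum>k\<le>n. ?t (Suc k))) =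
        (\<Sum>k\<le>Suc n. smult (S (Suc n) k) (?w k))"
      by (subst sum.atMost_Suc_shift)
         (simp add: S_Suc_0 S_Suc_Suc sum.distrib smult_add_left algebra_simps)
    finally show ?case .
  qed
  show ?thesis
  proof (induction n rule: less_induct)
    case (less n)
    have "(\<Sum>k\<le>n. S n k * v k) = (\<Sum>k\<le>n. S n k * moment_functional \<mu> (?w k))"
      using moment_functional_monom[of \<mu> 1 n]
      by (simp add: expansion moments moment_functional_sum moment_functional_smult)
    then show ?case
      using less by (simp add: S_self flip: lessThan_Suc_atMost)
  qed
qed

text \<open>Reduces an identity linear in \<open>f\<close> to Newton polynomials, over any
  commutative ring. The induction runs on \<open>f * newton_poly a k\<close> for all
  \<open>k\<close> at once, since \<open>z w_k = w_(k+1) + a_k w_k\<close>.\<close>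

lemma newton_poly_span:
  assumes newton: "\<And>k. P (newton_poly a k)"
    and add: "\<And>f g. P f \<Longrightarrow> P g \<Longrightarrow> P (f + g)"
    and smult: "\<And>c f. P f \<Longrightarrow> P (smult c f)"
  shows "P f"
proof -
  have zero: "P 0"
    using smult[OF newton[of 0], of 0] by simp
  have "P (f * newton_poly a k)" for k
  proof (induction f arbitrary: k)
    case 0
    then show ?case using zero by simp
  next
    case (pCons c f)
    have "pCons c f * newton_poly a k =
        smult c (newton_poly a k) +
        (f * newton_poly a (Suc k) + smult (a k) (f * newton_poly a k))"
      by (simp add: newton_poly_Suc algebra_simps flip: mult.assoc)
    then show ?case
      using newton add smult pCons.IH by metis
  qed
  from this[of 0] show ?thesis by simp
qed

section \<open>q-integers, Gaussian binomials and the q-binomial theorem\<close>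

definition qint :: "'a::comm_ring_1 \<Rightarrow> nat \<Rightarrow> 'a" where
  "qint q n = (\<Sum>i<n. q ^ i)"

lemma qint_0 [simp]: "qint q 0 = 0"
  by (simp add: qint_def)

lemma qint_Suc: "qint q (Suc n) = 1 + q * qint q n"
  unfolding qint_def by (subst sum.lessThan_Suc_shift) (simp add: sum_distrib_left)

lemma qint_telescope: "(1 - q) * qint q n = 1 - q ^ n"
  proof (induction n)
  case (Suc n)
  have "(1 - q) * qint q (Suc n) = (1 - q) * qint q n + (1 - q) * q ^ n"
    by (simp add: qint_def distrib_left)
  then show ?case
    using Suc by (simp add: left_diff_distrib)
qed simp

text \<open>The q-Pascal rule, like the sum defining \<open>qint\<close>, avoids division, so both
  make sense in the polynomial ring with \<open>q\<close> a constant polynomial.\<close>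

fun gauss_binom :: "'a::comm_ring_1 \<Rightarrow> nat \<Rightarrow> nat \<Rightarrow> 'a" where
  "gauss_binom q n 0 = 1"
| "gauss_binom q 0 (Suc k) = 0"
| "gauss_binom q (Suc n) (Suc k) = gauss_binom q n k + q ^ Suc k * gauss_binom q n (Suc k)"

lemma gauss_binom_eq_0: "n < k \<Longrightarrow> gauss_binom q n k = 0"
  by (induction q n k rule: gauss_binom.induct) auto

lemma gauss_binom_self: "gauss_binom q n n = 1"
  by (induction n) (simp_all add: gauss_binom_eq_0)

lemma gauss_binom_absorb:
  "qint q (Suc k) * gauss_binom q (Suc n) (Suc k) = qint q (Suc n) * gauss_binom q n k"
proof (induction n arbitrary: k)
  case 0
  then show ?case by (cases k) (simp_all add: qint_Suc)
next
  case (Suc n)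
  show ?case
  proof (cases k)
    case 0
    then show ?thesis using Suc[of 0] by (simp add: qint_Suc algebra_simps)
  next
    case (Suc j)
    let ?B = "gauss_binom q"
    have 1: "qint q (Suc j) * ?B (Suc n) (Suc j) = qint q (Suc n) * ?B n j"
      and 2: "qint q (Suc k) * ?B (Suc n) (Suc k) = qint q (Suc n) * ?B n k"
      using Suc.IH by blast+
    have "qint q (Suc k) * ?B (Suc (Suc n)) (Suc k) =
        (1 + q * qint q (Suc j)) * ?B (Suc n) (Suc j)
        + q ^ Suc k * (qint q (Suc k) * ?B (Suc n) (Suc k))"
      by (simp add: Suc qint_Suc algebra_simps del: gauss_binom.simps(3))
         (simp add: algebra_simps)
    also have "\<dots> = ?B (Suc n) (Suc j) + q * (qint q (Suc j) * ?B (Suc n) (Suc j))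
        + q ^ Suc k * (qint q (Suc n) * ?B n k)"
      by (simp only: 2 distrib_right mult_1_left mult.assoc)
    also have "\<dots> = ?B (Suc n) (Suc j) + q * qint q (Suc n) * (?B n j + q ^ k * ?B n k)"
      by (simp only: 1) (simp add: algebra_simps)
    also have "?B n j + q ^ k * ?B n k = ?B (Suc n) k"
      by (simp add: Suc)
    finally show ?thesis
      by (simp add: Suc qint_Suc[of q "Suc n"] algebra_simps del: gauss_binom.simps(3))
  qed
qed

text \<open>For \<open>k \<le> n + 1\<close> this is the companion absorption rule
  \<open>[n + 1 - k] B (n + 1) k = [n + 1] B n k\<close>, multiplied by
  \<open>q^k (1 - q)\<close>.\<close>

lemma gauss_binom_power_diff:
  "(q ^ k - q ^ Suc n) * gauss_binom q (Suc n) k =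
     q ^ k * (1 - q) * qint q (Suc n) * gauss_binom q n k"
proof (cases k)
  case 0
  then show ?thesis by (simp add: qint_telescope)
next
  case (Suc j)
  have "(1 - q ^ k) * gauss_binom q (Suc n) k = (1 - q ^ Suc n) * gauss_binom q n j"
    using arg_cong[OF gauss_binom_absorb[of q j n], of "\<lambda>t. (1 - q) * t"]
    unfolding Suc by (simp only: qint_telescope flip: mult.assoc)
  moreover have "gauss_binom q (Suc n) k = gauss_binom q n j + q ^ k * gauss_binom q n k"
    by (simp add: Suc)
  ultimately have "(q ^ k - q ^ Suc n) * gauss_binom q (Suc n) k =
      q ^ k * (1 - q ^ Suc n) * gauss_binom q n k"
    unfolding left_diff_distrib right_diff_distrib mult_1 by (simp add: algebra_simps)
  then show ?thesis
    by (simp only: mult.assoc flip: qint_telescope)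
qed

lemma choose_two_Suc: "Suc k choose 2 = (k choose 2) + k"
  by (simp add: numeral_2_eq_2)

text \<open>Splitting off the factor \<open>j = 0\<close> turns \<open>y\<close> into
  \<open>q y\<close> in the remaining product, hence the induction for arbitrary \<open>y\<close>;
  q-Pascal recombines the two sums.\<close>

lemma gauss_binomial_theorem:
  "(\<Sum>k\<le>n. gauss_binom q n k * q ^ (k choose 2) * y ^ k * c ^ (n - k)) = (\<Prod>j<n. q ^ j * y + c)"
proof (induction n arbitrary: y)
  case 0
  then show ?case by (simp add: numeral_2_eq_2)
next
  case (Suc n)
  let ?t = "\<lambda>k. gauss_binom q n k * q ^ (k choose 2) * (q * y) ^ k * c ^ (n - k)"
  have "(\<Prod>j<Suc n. q ^ j * y + c) = (y + c) * (\<Prod>j<n. q ^ j * (q * y) + c)"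
    by (subst prod.lessThan_Suc_shift) (simp add: algebra_simps)
  also have "\<dots> = y * (\<Sum>k\<le>n. ?t k) + c * (\<Sum>k\<le>n. ?t k)"
    by (simp only: Suc[symmetric] distrib_right)
  also have "(\<Sum>k\<le>n. ?t k) = c ^ n + (\<Sum>k\<le>n. ?t (Suc k))"
    using sum.atMost_Suc_shift[of ?t n] by (simp add: gauss_binom_eq_0 numeral_2_eq_2)
  then have "c * (\<Sum>k\<le>n. ?t k) = c ^ Suc n + (\<Sum>k\<le>n. c * ?t (Suc k))"
    by (simp add: algebra_simps sum_distrib_left)
  also have "(\<Sum>k\<le>n. c * ?t (Suc k)) =
      (\<Sum>k\<le>n. q ^ Suc k * gauss_binom q n (Suc k) * q ^ (Suc k choose 2) * y ^ Suc k * c ^ (n - k))"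
  proof (rule sum.cong)
    fix k assume "k \<in> {..n}"
    then show "c * ?t (Suc k) = q ^ Suc k * gauss_binom q n (Suc k) * q ^ (Suc k choose 2)
        * y ^ Suc k * c ^ (n - k)"
    proof (cases "k = n")
      case False
      with \<open>k \<in> {..n}\<close> have "n - k = Suc (n - Suc k)" by auto
      then show ?thesis by (simp add: power_mult_distrib algebra_simps)
    qed (simp add: gauss_binom_eq_0)
  qed simp
  also have "y * (\<Sum>k\<le>n. ?t k) =
      (\<Sum>k\<le>n. gauss_binom q n k * q ^ (Suc k choose 2) * y ^ Suc k * c ^ (n - k))"
    by (simp add: sum_distrib_left choose_two_Suc power_add power_mult_distrib algebra_simps)
  also have "\<dots> + (c ^ Suc n + (\<Sum>k\<le>n. q ^ Suc k * gauss_binom q n (Suc k)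
        * q ^ (Suc k choose 2) * y ^ Suc k * c ^ (n - k))) =
      c ^ Suc n + (\<Sum>k\<le>n. gauss_binom q (Suc n) (Suc k)
        * q ^ (Suc k choose 2) * y ^ Suc k * c ^ (n - k))"
    by (simp add: sum.distrib algebra_simps)
  also have "\<dots> = (\<Sum>k\<le>Suc n. gauss_binom q (Suc n) k
        * q ^ (k choose 2) * y ^ k * c ^ (Suc n - k))"
    by (subst sum.atMost_Suc_shift) (simp add: numeral_2_eq_2 del: gauss_binom.simps(3))
  finally show ?case ..
qed

section \<open>Substitution of a linear polynomial\<close>

lemma degree_pcompose_linear_le: "degree (pcompose g [:b, c:]) \<le> degree g"
proof -
  have "degree (pcompose g [:b, c:]) \<le> degree g * degree [:b, c:]"
    by (rule degree_pcompose_le)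
  also have "\<dots> \<le> degree g * 1"
    by (intro mult_left_mono) simp_all
  finally show ?thesis by simp
qed

text \<open>Only the power \<open>(b + c z)^n\<close> reaches degree \<open>n\<close>. Here
  \<open>n\<close> is a bound on the degree, so a vanishing coefficient is covered too.\<close>

lemma coeff_pcompose_linear:
  fixes b c :: "'a::comm_ring_1"
  assumes "degree g \<le> n"
  shows "coeff (pcompose g [:b, c:]) n = coeff g n * c ^ n"
  using assms
proof (induction n arbitrary: g)
  case 0
  then obtain d where "g = [:d:]"
    by (metis degree_0_id le_zero_eq)
  then show ?case by (simp add: pcompose_const)
next
  case (Suc n)
  obtain d g' where g: "g = pCons d g'"
    by (cases g)
  have g': "degree g' \<le> n"
    using Suc.prems by (cases "g' = 0") (simp_all add: g)
  have "coeff (pcompose g' [:b, c:]) (Suc n) = 0"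
    using degree_pcompose_linear_le[of g' b c] g' by (intro coeff_eq_0) simp
  then show ?case
    using Suc.IH[OF g'] by (simp add: g pcompose_pCons coeff_pCons algebra_simps)
qed

section \<open>Orthogonal polynomials of a q-moment functional\<close>

locale q_moment =
  fixes q a0 X :: "'a::comm_ring_1" and \<mu> :: "nat \<Rightarrow> 'a" and a :: "nat \<Rightarrow> 'a"
  assumes a_0: "a 0 = a0"
    and a_Suc: "a (Suc k) = q * a k + 1"
    and newton_moment: "moment_functional \<mu> (newton_poly a k) = q ^ (k choose 2) * X ^ k"
begin

abbreviation "L \<equiv> moment_functional \<mu>"
abbreviation "w \<equiv> newton_poly a"
abbreviation "shift f \<equiv> pcompose f [:1, q:]"

text \<open>For \<open>a0 = [r]\<close> this is \<open>q^r\<close>.\<close>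

definition R :: 'a where "R = 1 - (1 - q) * a0"

text \<open>The ring form of \<open>[r + k] = [r] + q^r [k]\<close>.\<close>

lemma a_eq: "a k = a0 + R * qint q k"
proof (induction k)
  case (Suc k)
  have "a (Suc k) = q * (a0 + R * qint q k) + 1"
    by (simp only: a_Suc Suc)
  then show ?case
    by (simp add: qint_Suc R_def algebra_simps)
qed (simp add: a_0)

text \<open>The substitution maps the factor \<open>z - a (k + 1)\<close> to \<open>q (z - a k)\<close>.\<close>

lemma shift_newton_tail: "shift (newton_poly (\<lambda>j. a (Suc j)) k) = smult (q ^ k) (w k)"
proof (induction k)
  case (Suc k)
  have "shift [:- a (Suc k), 1:] = smult q [:- a k, 1:]"
    by (simp add: pcompose_pCons a_Suc)
  then show ?case
    by (simp only: newton_poly_Suc pcompose_mult Suc mult_smult_left mult_smult_right smult_smult)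
       (simp only: power_Suc mult.commute)
qed (simp add: pcompose_1)

text \<open>The first factor becomes \<open>q z + 1 - a_0 = q (z - a_k) + R [k + 1]\<close>, and the
  others become \<open>q^k w_k\<close>.\<close>

lemma shift_newton_Suc:
  "shift (w (Suc k)) = smult (q ^ Suc k) (w (Suc k)) + smult (q ^ k * R * qint q (Suc k)) (w k)"
proof -
  have "1 - a0 = R * qint q (Suc k) - q * a k"
    using a_eq[of "Suc k"] by (simp add: a_Suc algebra_simps)
  then have "shift [:- a 0, 1:] = smult q [:- a k, 1:] + [:R * qint q (Suc k):]"
    by (simp add: pcompose_pCons a_0)
  then have "shift (w (Suc k)) =
      (smult q [:- a k, 1:] + [:R * qint q (Suc k):]) * smult (q ^ k) (w k)"
    by (simp only: newton_poly_Suc_shift pcompose_mult shift_newton_tail)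
  also have "\<dots> = smult (q ^ Suc k) (w k * [:- a k, 1:]) + smult (q ^ k * R * qint q (Suc k)) (w k)"
    by (simp add: algebra_simps smult_add_right smult_diff_right smult_diff_left)
  finally show ?thesis
    by (simp only: newton_poly_Suc)
qed

text \<open>Both sides are linear in \<open>g\<close>, so it suffices to test the Newton polynomials
  with nodes \<open>a_1, a_2, ...\<close>. The left side is then the moment of
  \<open>w_(k+1)\<close>, the right side \<open>X q^k\<close> times that of
  \<open>w_k\<close>.\<close>

lemma L_linear_mult: "L ([:- a0, 1:] * g) = X * L (shift g)"
proof (rule newton_poly_span[of "\<lambda>g. L ([:- a0, 1:] * g) = X * L (shift g)"])
  fix k
  have "L ([:- a0, 1:] * newton_poly (\<lambda>j. a (Suc j)) k) = L (w (Suc k))"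
    by (simp only: newton_poly_Suc_shift a_0)
  also have "\<dots> = X * L (shift (newton_poly (\<lambda>j. a (Suc j)) k))"
    by (simp add: newton_moment shift_newton_tail moment_functional_smult choose_two_Suc
        power_add algebra_simps)
  finally show "L ([:- a0, 1:] * newton_poly (\<lambda>j. a (Suc j)) k) =
      X * L (shift (newton_poly (\<lambda>j. a (Suc j)) k))" .
qed (simp_all only: distrib_left mult_smult_right moment_functional_add moment_functional_smult
      pcompose_add pcompose_smult mult.left_commute)

text \<open>For \<open>n = 0\<close> the truncated exponent \<open>n - 1\<close> is harmless: the only coefficient has \<open>n - k = 0\<close>.\<close>

definition orth_coeff :: "nat \<Rightarrow> nat \<Rightarrow> 'a" where
  "orth_coeff n k = gauss_binom q n k * (- (q ^ (n - 1) * X)) ^ (n - k)"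

definition orth_poly :: "nat \<Rightarrow> 'a poly" where
  "orth_poly n = (\<Sum>k\<le>n. smult (orth_coeff n k) (w k))"

text \<open>The factor \<open>\<beta>\<^sub>n\<close> of the overview. Its last bracket becomes
  \<open>q^r (1 - q^n (1 - q) x)\<close>, the source of the q-Pochhammer symbols.\<close>

definition lower :: "nat \<Rightarrow> 'a" where
  "lower n = qint q (Suc n) * q ^ n * (R - (1 - q) * q ^ n * X)"

text \<open>Compares coefficients of \<open>w_k\<close> in \<open>shift_orth_poly\<close>; on the
  left are the contributions of \<open>shift (w k)\<close> and \<open>shift (w (Suc k))\<close>. The
  two absorption rules turn everything into multiples of \<open>gauss_binom q n k\<close>.\<close>

lemma orth_coeff_shift:
  assumes "k \<le> n"
  shows "q ^ k * orth_coeff (Suc n) k + q ^ k * R * qint q (Suc k) * orth_coeff (Suc n) (Suc k) =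
     q ^ Suc n * orth_coeff (Suc n) k + lower n * orth_coeff n k"
proof -
  let ?c = "- (q ^ n * X)" and ?B = "gauss_binom q"
  \<comment> \<open>Each of the \<open>n - k\<close> factors \<open>q^n\<close> gives up one
    \<open>q\<close>; together with \<open>q^k\<close> these make \<open>q^n\<close>.\<close>
  have pow: "q ^ k * ?c ^ (n - k) = q ^ n * (- (q ^ (n - 1) * X)) ^ (n - k)"
  proof (cases "k = n")
    case False
    then obtain m where n: "n = Suc m"
      using assms by (cases n) auto
    define d where "d = n - k"
    have d: "k + d = n"
      using assms by (simp add: d_def)
    have "?c = q * (- (q ^ m * X))" by (simp add: n)
    then have "q ^ k * ?c ^ d = q ^ (k + d) * (- (q ^ m * X)) ^ d"
      by (simp only: power_mult_distrib power_add) (simp only: mult.assoc)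
    then show ?thesis
      by (simp only: d d_def[symmetric]) (simp only: n diff_Suc_1)
  qed simp
  have Suc_pow: "?c ^ (Suc n - k) = ?c * ?c ^ (n - k)"
    using assms by (simp add: Suc_diff_le)
  have "q ^ k * orth_coeff (Suc n) k - q ^ Suc n * orth_coeff (Suc n) k =
      ((q ^ k - q ^ Suc n) * ?B (Suc n) k) * ?c * ?c ^ (n - k)"
    by (simp only: orth_coeff_def Suc_pow diff_Suc_1) (simp only: algebra_simps)
  also have "\<dots> = (1 - q) * ?c * qint q (Suc n) * ?B n k * (q ^ k * ?c ^ (n - k))"
    by (simp only: gauss_binom_power_diff) (simp only: mult.assoc mult.commute mult.left_commute)
  finally have 1: "q ^ k * orth_coeff (Suc n) k - q ^ Suc n * orth_coeff (Suc n) k =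
      (1 - q) * ?c * qint q (Suc n) * ?B n k * (q ^ n * (- (q ^ (n - 1) * X)) ^ (n - k))"
    by (simp only: pow)
  have "q ^ k * R * qint q (Suc k) * orth_coeff (Suc n) (Suc k) =
      R * (qint q (Suc k) * ?B (Suc n) (Suc k)) * (q ^ k * ?c ^ (n - k))"
    by (simp only: orth_coeff_def diff_Suc_1 diff_Suc_Suc)
       (simp only: mult.assoc mult.commute mult.left_commute)
  also have "\<dots> = R * qint q (Suc n) * ?B n k * (q ^ n * (- (q ^ (n - 1) * X)) ^ (n - k))"
    by (simp only: gauss_binom_absorb pow) (simp only: mult.assoc)
  finally have 2: "q ^ k * R * qint q (Suc k) * orth_coeff (Suc n) (Suc k) =
      R * qint q (Suc n) * ?B n k * (q ^ n * (- (q ^ (n - 1) * X)) ^ (n - k))" .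
  show ?thesis
    unfolding 1[unfolded diff_eq_eq] 2 lower_def orth_coeff_def[of n k]
    by (simp add: algebra_simps)
qed

text \<open>The substitution acts as a lowering operator up to a multiple of the polynomial itself;
  this drives the descent from \<open>n + 1\<close> to \<open>n\<close> in
  \<open>L_mult_orth_poly\<close>.\<close>

lemma shift_orth_poly:
  "shift (orth_poly (Suc n)) = smult (q ^ Suc n) (orth_poly (Suc n)) + smult (lower n) (orth_poly n)"
proof -
  let ?C = "orth_coeff (Suc n)"
  have top: "?C (Suc n) = 1"
    by (simp add: orth_coeff_def gauss_binom_self del: gauss_binom.simps(3))
  have "shift (orth_poly (Suc n)) = (\<Sum>k\<le>Suc n. smult (?C k) (shift (w k)))"
    by (simp add: orth_poly_def pcompose_add pcompose_sum pcompose_smult)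
  also have "\<dots> = smult (?C 0) (w 0) + (\<Sum>k\<le>n. smult (?C (Suc k) * q ^ Suc k) (w (Suc k)))
      + (\<Sum>k\<le>n. smult (q ^ k * R * qint q (Suc k) * ?C (Suc k)) (w k))"
    by (subst sum.atMost_Suc_shift)
       (simp add: shift_newton_Suc pcompose_1 smult_add_right sum.distrib algebra_simps del: power_Suc)
  also have "smult (?C 0) (w 0) + (\<Sum>k\<le>n. smult (?C (Suc k) * q ^ Suc k) (w (Suc k))) =
      (\<Sum>k\<le>Suc n. smult (q ^ k * ?C k) (w k))"
    by (subst sum.atMost_Suc_shift) (simp add: algebra_simps)
  also have "(\<Sum>k\<le>Suc n. smult (q ^ k * ?C k) (w k))
      + (\<Sum>k\<le>n. smult (q ^ k * R * qint q (Suc k) * ?C (Suc k)) (w k)) =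
      (\<Sum>k\<le>n. smult (q ^ k * ?C k + q ^ k * R * qint q (Suc k) * ?C (Suc k)) (w k))
      + smult (q ^ Suc n * ?C (Suc n)) (w (Suc n))"
    by (simp add: sum.distrib smult_add_left)
  also have "(\<Sum>k\<le>n. smult (q ^ k * ?C k + q ^ k * R * qint q (Suc k) * ?C (Suc k)) (w k)) =
      (\<Sum>k\<le>n. smult (q ^ Suc n * ?C k + lower n * orth_coeff n k) (w k))"
    by (rule sum.cong) (simp_all only: orth_coeff_shift atMost_iff)
  also have "\<dots> = smult (q ^ Suc n) (\<Sum>k\<le>n. smult (?C k) (w k)) + smult (lower n) (orth_poly n)"
    by (simp add: sum.distrib smult_add_left orth_poly_def smult_sum_right)
  finally show ?thesis
    by (simp add: orth_poly_def[of "Suc n"] smult_add_right)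
qed

text \<open>The q-binomial theorem turns the value into a product whose factor \<open>j = n\<close>
  is \<open>q^n X - q^n X\<close>; this explains the constant in \<open>orth_coeff\<close>.\<close>

lemma L_orth_poly_Suc: "L (orth_poly (Suc n)) = 0"
proof -
  let ?c = "- (q ^ n * X)"
  have "L (orth_poly (Suc n)) =
      (\<Sum>k\<le>Suc n. gauss_binom q (Suc n) k * q ^ (k choose 2) * X ^ k * ?c ^ (Suc n - k))"
    unfolding orth_poly_def moment_functional_sum moment_functional_smult newton_moment
      orth_coeff_def diff_Suc_1
    by (rule sum.cong) (simp_all only: mult.assoc mult.commute mult.left_commute)
  also have "\<dots> = (\<Prod>j<Suc n. q ^ j * X + ?c)"
    by (rule gauss_binomial_theorem)
  also have "\<dots> = 0"
    by simp
  finally show ?thesis .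
qed

text \<open>The value of \<open>L (orth_poly n * orth_poly n)\<close>. In the step, \<open>X\<close>
  comes from \<open>L_linear_mult\<close>, \<open>q^n\<close> from the top coefficient of a shifted
  polynomial, and \<open>lower n\<close> from \<open>shift_orth_poly\<close>.\<close>

fun orth_norm :: "nat \<Rightarrow> 'a" where
  "orth_norm 0 = 1"
| "orth_norm (Suc n) = X * q ^ n * lower n * orth_norm n"

lemma L_const: "L [:c:] = c"
  using newton_moment[of 0] moment_functional_smult[of \<mu> c 1]
  by (simp add: numeral_2_eq_2)

text \<open>Nested induction: on \<open>n\<close>, then on the degree of \<open>f\<close>. Write
  \<open>f = c + (z - a0) g\<close>; the constant contributes nothing, and
  \<open>L_linear_mult\<close> with \<open>shift_orth_poly\<close> leaves two terms. The one with
  \<open>orth_poly (Suc n)\<close> vanishes by the inner hypothesis, the one with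
  \<open>orth_poly n\<close> is given by the outer.\<close>

lemma L_mult_orth_poly:
  "degree f \<le> n \<Longrightarrow> L (f * orth_poly n) = coeff f n * orth_norm n"
proof (induction n arbitrary: f)
  case 0
  then obtain d where "f = [:d:]"
    by (metis degree_0_id le_zero_eq)
  then show ?case by (simp add: orth_poly_def orth_coeff_def L_const)
next
  case (Suc n)
  note outer = Suc.IH
  from Suc.prems show ?case
  proof (induction "degree f" arbitrary: f rule: less_induct)
    case less
    define g where "g = synthetic_div f a0"
    define c where "c = poly f a0"
    have f: "f = [:c:] + [:- a0, 1:] * g"
      using synthetic_div_correct'[of a0 f] by (simp add: g_def c_def add.commute)
    have deg_g: "degree g = degree f - 1"
      by (simp add: g_def degree_synthetic_div)
    then have g_n: "degree g \<le> n"
      using less.prems by simp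
    then have "coeff g (Suc n) = 0"
      by (intro coeff_eq_0) simp
    then have coeff_f: "coeff f (Suc n) = coeff g n"
      by (subst f) (simp add: coeff_pCons)
    have shift_g: "degree (shift g) \<le> degree g"
      by (rule degree_pcompose_linear_le)
    then have shift_g_0: "coeff (shift g) (Suc n) = 0"
      using g_n by (intro coeff_eq_0) simp
    have 1: "L (shift g * orth_poly (Suc n)) = 0"
    proof (cases "degree f = 0")
      case True
      then have "g = 0"
        by (simp add: g_def synthetic_div_eq_0_iff)
      then show ?thesis by simp
    next
      case False
      then show ?thesis
        using less.hyps[of "shift g"] shift_g deg_g g_n shift_g_0 by simp
    qed
    have 2: "L (shift g * orth_poly n) = q ^ n * coeff g n * orth_norm n"
      using outer[of "shift g"] shift_g g_n
      by (simp add: coeff_pcompose_linear[OF g_n] mult.commute)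
    have "f * orth_poly (Suc n) =
        smult c (orth_poly (Suc n)) + [:- a0, 1:] * (g * orth_poly (Suc n))"
      by (subst f) (simp add: distrib_right flip: mult.assoc)
    then have "L (f * orth_poly (Suc n)) = X * L (shift g * shift (orth_poly (Suc n)))"
      by (simp only: moment_functional_add moment_functional_smult L_orth_poly_Suc
          L_linear_mult pcompose_mult) simp
    also have "\<dots> = X * (q ^ Suc n * L (shift g * orth_poly (Suc n))
        + lower n * L (shift g * orth_poly n))"
      by (simp only: shift_orth_poly distrib_left mult_smult_right moment_functional_add
          moment_functional_smult)
    finally show ?case
      unfolding 1 2 coeff_f by (simp add: algebra_simps)
  qed
qed

lemma degree_orth_poly_le: "degree (orth_poly n) \<le> n"
  unfolding orth_poly_def
  by (intro degree_sum_le) (auto intro: order_trans[OF degree_smult_le] order_trans[OF degree_newton_poly_le])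

lemma coeff_orth_poly_self: "coeff (orth_poly n) n = 1"
proof -
  have "coeff (orth_poly n) n = (\<Sum>k\<le>n. if k = n then 1 else 0)"
    unfolding orth_poly_def coeff_sum
  proof (rule sum.cong)
    fix k assume "k \<in> {..n}"
    show "coeff (smult (orth_coeff n k) (w k)) n = (if k = n then 1 else 0)"
    proof (cases "k = n")
      case True
      then show ?thesis
        by (simp add: coeff_newton_poly_self orth_coeff_def gauss_binom_self)
    next
      case False
      then have "coeff (w k) n = 0"
        using degree_newton_poly_le[of a k] \<open>k \<in> {..n}\<close> by (intro coeff_eq_0) simp
      then show ?thesis using False by simp
    qed
  qed simp
  then show ?thesis by simp
qed

section \<open>Hankel determinants of the moments\<close>

lemma L_monom_mult_orth_poly:
  "L (monom 1 j * orth_poly n) = (\<Sum>k\<le>n. coeff (orth_poly n) k * \<mu> (k + j))"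
proof -
  have "monom 1 j * orth_poly n = (\<Sum>k\<le>n. monom (coeff (orth_poly n) k) (k + j))"
    by (subst poly_as_sum_of_monoms'[OF degree_orth_poly_le, symmetric])
       (simp add: sum_distrib_left mult_monom add.commute)
  then show ?thesis
    by (simp add: moment_functional_sum moment_functional_monom)
qed

lemma L_monom_orth_poly:
  assumes "j \<le> n"
  shows "L (monom 1 j * orth_poly n) = (if j = n then orth_norm n else 0)"
  using assms by (subst L_mult_orth_poly) (auto intro: order_trans[OF degree_monom_le])

text \<open>With \<open>P\<close> the unitriangular matrix of coefficients of the orthogonal
  polynomials, \<open>P * H\<close> has entries \<open>L (z^j p_i)\<close>. Orthogonality makes it
  upper triangular with the norms on the diagonal.\<close>

lemma det_hankel: "det (mat n n (\<lambda>(i, j). \<mu> (i + j))) = (\<Prod>i<n. orth_norm i)"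
proof -
  define H where "H = mat n n (\<lambda>(i, j). \<mu> (i + j))"
  define P where "P = mat n n (\<lambda>(i, j). coeff (orth_poly i) j)"
  have H: "H \<in> carrier_mat n n" and P: "P \<in> carrier_mat n n"
    by (simp_all add: H_def P_def)
  have PH: "(P * H) $$ (i, j) = L (monom 1 j * orth_poly i)" if "i < n" "j < n" for i j
  proof -
    have "(P * H) $$ (i, j) = (\<Sum>k = 0..<n. coeff (orth_poly i) k * \<mu> (k + j))"
      using that by (simp add: P_def H_def scalar_prod_def)
    also have "\<dots> = (\<Sum>k\<le>i. coeff (orth_poly i) k * \<mu> (k + j))"
      using that degree_orth_poly_le[of i]
      by (intro sum.mono_neutral_right) (auto simp: coeff_eq_0)
    finally show ?thesis
      by (simp add: L_monom_mult_orth_poly)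
  qed
  have "det P = prod_list (diag_mat P)"
    by (rule det_lower_triangular[OF _ P])
       (use degree_orth_poly_le in \<open>auto simp: P_def intro!: coeff_eq_0 intro: le_less_trans\<close>)
  also have "\<dots> = 1"
    by (simp add: prod_list_diag_prod P_def coeff_orth_poly_self)
  finally have "det H = det (P * H)"
    by (simp add: det_mult[OF P H])
  also have "\<dots> = prod_list (diag_mat (P * H))"
  proof (rule det_upper_triangular)
    show "upper_triangular (P * H)"
      unfolding upper_triangular_def using P H
      by (auto simp: PH L_monom_orth_poly simp del: index_mult_mat(1))
  qed (rule mult_carrier_mat[OF P H])
  also have "\<dots> = (\<Prod>i<n. orth_norm i)"
    using P H by (simp add: prod_list_diag_prod PH L_monom_orth_poly atLeast0LessThan del: index_mult_mat(1))
  finally show ?thesis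
    by (simp add: H_def)
qed

end

text \<open>In the first row only the last entry can be nonzero, and deleting its row and column
  leaves an identity matrix.\<close>

lemma det_companion:
  fixes c :: "nat \<Rightarrow> 'a::comm_ring_1"
  assumes "n > 0"
  shows "det (mat n n (\<lambda>(i, j). if j = n - 1 then - c i else if i = Suc j then 1 else 0)) =
     (- 1) ^ n * c 0"
proof -
  define C where "C = mat n n (\<lambda>(i, j). if j = n - 1 then - c i else if i = Suc j then 1 else 0)"
  have C: "C \<in> carrier_mat n n"
    by (simp add: C_def)
  have "det C = (\<Sum>j<n. C $$ (0, j) * cofactor C 0 j)"
    by (rule laplace_expansion_row[OF C assms])
  also have "\<dots> = (\<Sum>j<n. if j = n - 1 then - c 0 * cofactor C 0 j else 0)"
    using assms by (intro sum.cong) (auto simp: C_def)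
  also have "\<dots> = - c 0 * cofactor C 0 (n - 1)"
    using assms by (subst sum.delta) simp_all
  also have "mat_delete C 0 (n - 1) = 1\<^sub>m (n - 1)"
    by (rule eq_matI) (auto simp: mat_delete_def C_def)
  then have "cofactor C 0 (n - 1) = (- 1) ^ (n - 1)"
    by (simp add: cofactor_def)
  also have "- c 0 * (- 1) ^ (n - 1) = (- 1) ^ n * c 0"
    using assms by (cases n) simp_all
  finally show ?thesis
    by (simp add: C_def)
qed

context q_moment
begin

lemma det_hankel_1:
  assumes "n > 0"
  shows "det (mat n n (\<lambda>(i, j). \<mu> (i + j + 1))) =
     det (mat n n (\<lambda>(i, j). \<mu> (i + j))) * ((- 1) ^ n * coeff (orth_poly n) 0)"
proof -
  let ?c = "coeff (orth_poly n)"
  define H where "H = mat n n (\<lambda>(i, j). \<mu> (i + j))"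
  define C where "C = mat n n (\<lambda>(i, j). if j = n - 1 then - ?c i else if i = Suc j then 1 else 0)"
  have H: "H \<in> carrier_mat n n" and C: "C \<in> carrier_mat n n"
    by (simp_all add: H_def C_def)
  have "mat n n (\<lambda>(i, j). \<mu> (i + j + 1)) = H * C"
  proof (rule eq_matI)
    fix i j assume "i < dim_row (H * C)" "j < dim_col (H * C)"
    then have ij: "i < n" "j < n"
      using H C by simp_all
    have HC: "(H * C) $$ (i, j) =
        (\<Sum>k = 0..<n. \<mu> (i + k) * (if j = n - 1 then - ?c k else if k = Suc j then 1 else 0))"
      using ij by (simp add: H_def C_def scalar_prod_def)
    have "(H * C) $$ (i, j) = \<mu> (i + j + 1)"
    proof (cases "j = n - 1")
      case True
      \<comment> \<open>Orthogonality of \<open>p_n\<close> to \<open>z^i\<close> for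
        \<open>i < n\<close> expresses the moment of index \<open>n + i\<close> through the
        \<open>n\<close> moments before it, as the last column requires.\<close>
      have "0 = (\<Sum>k\<le>n. ?c k * \<mu> (k + i))"
        using L_monom_orth_poly[of i n] ij by (simp add: L_monom_mult_orth_poly)
      also have "\<dots> = (\<Sum>k<n. ?c k * \<mu> (k + i)) + \<mu> (n + i)"
        by (simp add: coeff_orth_poly_self flip: lessThan_Suc_atMost)
      finally have "\<mu> (n + i) = - (\<Sum>k<n. ?c k * \<mu> (k + i))"
        by (metis add.commute add_eq_0_iff2)
      moreover have "i + j + 1 = n + i"
        using True assms by simp
      moreover have "(H * C) $$ (i, j) = - (\<Sum>k<n. ?c k * \<mu> (k + i))"
        using True HC by (simp add: sum_negf atLeast0LessThan algebra_simps)
      ultimately show ?thesis by (simp only:)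
    next
      case False
      then have "(H * C) $$ (i, j) = (\<Sum>k = 0..<n. if k = Suc j then \<mu> (i + k) else 0)"
        unfolding HC by (intro sum.cong) auto
      then show ?thesis
        using False ij by simp
    qed
    then show "mat n n (\<lambda>(i, j). \<mu> (i + j + 1)) $$ (i, j) = (H * C) $$ (i, j)"
      using ij by simp
  qed (use H C in simp_all)
  then show ?thesis
    using det_mult[OF H C] det_companion[OF assms, of ?c] by (simp add: H_def C_def)
qed

text \<open>Evaluating \<open>w_k\<close> at zero gives the sign \<open>(-1)^k\<close>, which
  cancels against the other two. Reversing the sum puts the power of \<open>X\<close> at
  \<open>k\<close>.\<close>

lemma coeff_0_orth_poly:
  "(- 1) ^ n * coeff (orth_poly n) 0 =
     (\<Sum>k\<le>n. gauss_binom q n (n - k) * (q ^ (n - 1) * X) ^ k * (\<Prod>j<n - k. a j))"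
proof -
  have w0: "coeff (w k) 0 = (- 1) ^ k * (\<Prod>j<k. a j)" for k
  proof -
    have "coeff (w k) 0 = (\<Prod>j<k. - a j)"
      by (simp add: newton_poly_def poly_prod flip: poly_0_coeff_0)
    then show ?thesis by (simp add: prod_uminus)
  qed
  have sgn: "(- 1) ^ n * ((- 1) ^ (n - k) * (- 1) ^ k) = (1::'a)" if "k \<le> n" for k
    using that by (simp flip: power_add mult_2)
  have "(- 1) ^ n * coeff (orth_poly n) 0 =
      (\<Sum>k\<le>n. gauss_binom q n k * (q ^ (n - 1) * X) ^ (n - k) * (\<Prod>j<k. a j))"
    unfolding orth_poly_def coeff_sum sum_distrib_left
  proof (rule sum.cong)
    fix k assume "k \<in> {..n}"
    have "(- 1) ^ n * coeff (smult (orth_coeff n k) (w k)) 0 =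
        ((- 1) ^ n * ((- 1) ^ (n - k) * (- 1) ^ k)) *
        (gauss_binom q n k * (q ^ (n - 1) * X) ^ (n - k) * (\<Prod>j<k. a j))"
      unfolding coeff_smult w0 orth_coeff_def power_minus[of "q ^ (n - 1) * X"]
      by (simp only: mult.assoc mult.left_commute mult.commute)
    then show "(- 1) ^ n * coeff (smult (orth_coeff n k) (w k)) 0 =
        gauss_binom q n k * (q ^ (n - 1) * X) ^ (n - k) * (\<Prod>j<k. a j)"
      using sgn[of k] \<open>k \<in> {..n}\<close> by simp
  qed simp
  also have "\<dots> = (\<Sum>k\<le>n. gauss_binom q n (n - k) * (q ^ (n - 1) * X) ^ k * (\<Prod>j<n - k. a j))"
    by (rule sum.reindex_bij_witness[of _ "\<lambda>k. n - k" "\<lambda>k. n - k"]) auto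
  finally show ?thesis .
qed

end

section \<open>Specialization to real \<open>q\<close> and the polynomials
  \<open>Phi\<close>\<close>

lemma qnum_of_nat: "q > 0 \<Longrightarrow> q \<noteq> 1 \<Longrightarrow> qnum q (real n) = qint q n"
  using qint_telescope[of q n] by (simp add: qnum_def powr_realpow field_simps)

lemma qint_pos: "q > 0 \<Longrightarrow> n > 0 \<Longrightarrow> qint (q::real) n > 0"
  unfolding qint_def by (intro sum_pos) auto

lemma qfact_0 [simp]: "qfact q 0 = 1"
  by (simp add: qfact_def)

lemma qfact_Suc: "qfact q (Suc n) = qfact q n * qnum q (real (Suc n))"
  by (simp add: qfact_def)

lemma qfact_neq_0: "q > 0 \<Longrightarrow> q \<noteq> 1 \<Longrightarrow> qfact q n \<noteq> 0"
proof (induction n)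
  case (Suc n)
  then show ?case
    using qint_pos[of q "Suc n"] by (simp add: qfact_Suc qnum_of_nat del: of_nat_Suc)
qed simp

text \<open>Both sides obey the absorption rule, and the positive factor \<open>[j + 1]\<close>
  cancels.\<close>

lemma gauss_binom_eq_qbinom:
  assumes "q > 0" "q \<noteq> 1"
  shows "gauss_binom q n k = qbinom q n k"
proof (induction n arbitrary: k)
  case 0
  then show ?case by (cases k) (simp_all add: qbinom_def)
next
  case (Suc n)
  show ?case
  proof (cases k)
    case 0
    then show ?thesis
      using qfact_neq_0[OF assms, of "Suc n"] by (simp add: qbinom_def)
  next
    case (Suc j)
    have pos: "qint q (Suc j) > 0"
      using assms by (simp add: qint_pos)
    have "qint q (Suc j) * gauss_binom q (Suc n) (Suc j) = qint q (Suc n) * qbinom q n j"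
      by (simp only: gauss_binom_absorb Suc.IH)
    also have "\<dots> = qint q (Suc j) * qbinom q (Suc n) (Suc j)"
      using pos assms
      by (simp add: qbinom_def qfact_Suc qnum_of_nat del: of_nat_Suc)
    finally show ?thesis
      using pos by (simp add: Suc del: gauss_binom.simps(3))
  qed
qed

lemma const_poly_power: "[:c:] ^ n = [:c ^ n:]" for c :: "'a::comm_ring_1"
  by (induction n) (simp_all add: one_pCons)

lemma const_poly_prod: "(\<Prod>i\<in>A. [:f i:]) = [:\<Prod>i\<in>A. f i:]" for f :: "'b \<Rightarrow> 'a::comm_ring_1"
  by (induction A rule: infinite_finite_induct) (simp_all add: one_pCons)

lemma gauss_binom_const_poly: "gauss_binom [:q:] n k = [:gauss_binom q n k:]"
  by (induction q n k rule: gauss_binom.induct) (simp_all add: const_poly_power one_pCons)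

lemma qint_const_poly: "qint [:q:] n = [:qint q n:]"
  by (induction n) (simp_all add: qint_Suc one_pCons)

lemma qStirling_Suc_0: "qStirling q (Suc n) 0 r = qnum q r * qStirling q n 0 r"
  by (cases n) simp_all

text \<open>The nodes \<open>[r + k]\<close> are exactly the weights in the recursion of
  \<open>qStirling\<close>, so \<open>moment_functional_newton_poly\<close> supplies the Newton
  moments.\<close>

lemma q_moment_Phi:
  assumes "q > 0" "q \<noteq> 1"
  shows "q_moment [:q:] [:qnum q r:] (smult (q powr r) x) (\<lambda>n. Phi q n x r)
     (\<lambda>k. [:qnum q (r + real k):])"
proof
  fix k
  have "qnum q (r + real (Suc k)) = q * qnum q (r + real k) + 1"
    using assms by (simp add: qnum_def powr_add field_simps)
  then show "[:qnum q (r + real (Suc k)):] = [:q:] * [:qnum q (r + real k):] + 1"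
    by (simp add: one_pCons)
  show "moment_functional (\<lambda>n. Phi q n x r) (newton_poly (\<lambda>k. [:qnum q (r + real k):]) k) =
      [:q:] ^ (k choose 2) * smult (q powr r) x ^ k"
  proof (rule moment_functional_newton_poly[where S = "\<lambda>n k. [:qStirling q n k r:]"])
    fix n
    show "Phi q n x r = (\<Sum>k\<le>n. [:qStirling q n k r:] * ([:q:] ^ (k choose 2) * smult (q powr r) x ^ k))"
      by (simp add: Phi_def const_poly_power atLeast0AtMost mult.commute)
  qed (simp_all only: qStirling_Suc_0 qStirling.simps(1,3), simp_all add: one_pCons add.commute)
qed simp

lemma choose_three_Suc: "Suc k choose 3 = (k choose 3) + (k choose 2)"
  by (simp add: numeral_3_eq_3 numeral_2_eq_2)

lemma qpoch_Suc: "qpoch q y (Suc n) = qpoch q y n * (1 - smult (q ^ n) y)"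
  by (simp add: qpoch_def)

context
  fixes q r :: real and x :: "real poly"
  assumes q: "q > 0" "q \<noteq> 1"
begin

interpretation q_moment "[:q:]" "[:qnum q r:]" "smult (q powr r) x" "\<lambda>n. Phi q n x r"
    "\<lambda>k. [:qnum q (r + real k):]"
  using q by (rule q_moment_Phi)

text \<open>Each step of \<open>orth_norm\<close> contributes \<open>q^n\<close> twice, once through
  \<open>lower\<close>, and \<open>q^r\<close> twice, through \<open>X\<close> and \<open>R\<close>.
  The factor \<open>[n + 1]\<close> in \<open>lower\<close> builds the q-factorial.\<close>

lemma orth_norm_Phi:
  "orth_norm n = smult (q powr (2 * real (n choose 2) + 2 * r * real n))
     (x ^ n * smult (qfact q n) (qpoch q (smult (1 - q) x) n))"
proof (induction n)
  case 0
  then show ?case using q by (simp add: qpoch_def numeral_2_eq_2)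
next
  case (Suc n)
  define z where "z = 1 - smult (q ^ n) (smult (1 - q) x)"
  have "R = [:q powr r:]"
    unfolding R_def using q by (simp add: qnum_def one_pCons)
  then have "R - (1 - [:q:]) * [:q:] ^ n * smult (q powr r) x =
      smult (q powr r) z"
    by (simp add: z_def const_poly_power one_pCons smult_diff_right algebra_simps)
  then have lower: "lower n = smult (qint q (Suc n) * q ^ n * q powr r) z"
    by (simp add: lower_def qint_const_poly const_poly_power mult.assoc mult.left_commute mult.commute)
  have "2 * real (Suc n choose 2) + 2 * r * real (Suc n) =
      2 * real (n choose 2) + 2 * r * real n + (real n + real n + r + r)"
    by (simp add: choose_two_Suc algebra_simps)
  then have e: "q powr (2 * real (Suc n choose 2) + 2 * r * real (Suc n)) =
      q powr (2 * real (n choose 2) + 2 * r * real n) * (q ^ n * q ^ n * q powr r * q powr r)"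
    using q by (simp only: powr_add powr_realpow)
  have "orth_norm (Suc n) = smult (q powr r * q ^ n * (qint q (Suc n) * q ^ n * q powr r)
        * (q powr (2 * real (n choose 2) + 2 * r * real n) * qfact q n))
      (x ^ Suc n * (qpoch q (smult (1 - q) x) n * z))"
    unfolding orth_norm.simps Suc lower const_poly_power
    by (simp add: algebra_simps)
  then show ?case
    unfolding e qfact_Suc qpoch_Suc qnum_of_nat[OF q] z_def[symmetric]
    by (simp add: algebra_simps)
qed

text \<open>The exponents of the norms add up by the hockey-stick identities for
  \<open>n choose 2\<close> and \<open>n choose 3\<close>.\<close>

lemma hankelD_0:
  "hankelD q x r n 0 = smult (q powr (2 * real (n choose 3) + 2 * r * real (n choose 2)))
     (x ^ (n choose 2) * (\<Prod>k<n. smult (qfact q k) (qpoch q (smult (1 - q) x) k)))"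
proof -
  have "(\<Prod>i<n. orth_norm i) = smult (q powr (2 * real (n choose 3) + 2 * r * real (n choose 2)))
     (x ^ (n choose 2) * (\<Prod>k<n. smult (qfact q k) (qpoch q (smult (1 - q) x) k)))"
  proof (induction n)
    case 0
    then show ?case using q by (simp add: numeral_2_eq_2 numeral_3_eq_3)
  next
    case (Suc n)
    let ?g = "smult (qfact q n) (qpoch q (smult (1 - q) x) n)"
    have "2 * real (Suc n choose 3) + 2 * r * real (Suc n choose 2) =
        2 * real (n choose 3) + 2 * r * real (n choose 2) + (2 * real (n choose 2) + 2 * r * real n)"
      by (simp add: choose_two_Suc choose_three_Suc algebra_simps)
    then have e: "q powr (2 * real (Suc n choose 3) + 2 * r * real (Suc n choose 2)) =
        q powr (2 * real (n choose 3) + 2 * r * real (n choose 2)) *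
        q powr (2 * real (n choose 2) + 2 * r * real n)"
      by (simp only: powr_add)
    show ?case
      unfolding prod.lessThan_Suc Suc unfolding orth_norm_Phi e unfolding choose_two_Suc power_add
      by (simp add: algebra_simps)
  qed
  then show ?thesis
    using det_hankel[of n] by (simp add: hankelD_def)
qed

lemma hankelD_1:
  assumes "n > 0"
  shows "hankelD q x r n 1 = hankelD q x r n 0 *
     (\<Sum>k\<le>n. smult (qbinom q n k) (smult (q powr (real n - 1 + r)) x ^ k *
        [:\<Prod>j<n - k. qnum q (r + real j):]))"
proof -
  \<comment> \<open>Since \<open>n > 0\<close>, truncated and real subtraction of one agree.\<close>
  have "q powr (real n - 1 + r) = q powr real (n - 1) * q powr r"
    using assms by (simp add: of_nat_diff flip: powr_add)
  then have pow: "[:q:] ^ (n - 1) * smult (q powr r) x = smult (q powr (real n - 1 + r)) x"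
    using q by (simp add: const_poly_power powr_realpow mult.commute)
  have sym: "qbinom q n (n - k) = qbinom q n k" if "k \<le> n" for k
    using that by (simp add: qbinom_def mult.commute)
  show ?thesis
    using det_hankel_1[OF assms]
    unfolding coeff_0_orth_poly hankelD_def pow const_poly_prod gauss_binom_const_poly
      gauss_binom_eq_qbinom[OF q]
    by (simp add: sym mult.commute)
qed

end

theorem theorem3p1:
  fixes q r :: real and n :: nat and x :: "real poly"
  assumes "q > 0" and "q \<noteq> 1" and "n \<ge> 1"
    and x_def: "x = [:0, 1:]"
  shows "hankelD q x r n 0 =
           smult (q powr (2 * real (n choose 3) + 2 * r * real (n choose 2)))
             (x ^ (n choose 2) *
              (\<Prod>k = 0..<n. smult (qfact q k) (qpoch q (smult (1 - q) x) k)))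
       \<and> hankelD q x r n 1 =
           hankelD q x r n 0 *
             (\<Sum>k = 0..n. smult (qbinom q n k)
                (smult (q powr (real n - 1 + r)) x ^ k *
                 [:\<Prod>j = 0..<n - k. qnum q (r + real j):]))"
  using hankelD_0[OF assms(1,2)] hankelD_1[OF assms(1,2)] \<open>n \<ge> 1\<close>
  by (simp add: atLeast0AtMost atLeast0LessThan)

end
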